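(* Assume that $(X,d)$ has the Heine–Borel property. Let $E_k\subset X$, $k\in\mathbb N$, be a sequence of Borel sets, let $I$ be an at most countable index set, let $E^i\subset X$ be Borel sets for $i\in I$, and let $g_k^i\in G$ ($i\in I$, $k\in\mathbb N$) be such that \[ \lim_{k} (g_k^{i'})^{-1}g_k^i=\infty\quad\text{for all } i\neq i',\qquad\qquad (g_k^i)^{-1}E_k\xrightarrow{L^1_{\mathrm{loc}}(\mu)}E^i\quad\text{as }k\to+\infty,\ \text{for every } i\in I . \] Let $F\colon\mathcal B(X)\times\mathcal A(X)\to[0,+\infty]$ be a functional satisfying - (semicontinuity) $F(B,U)\le\liminf_k F(B_k,U)$ whenever $B_k\to B$ in $L^1_{\mathrm{loc}}(\mu)$; - (Beppo Levi) if $U_k\nearrow X$, then $F(D,U_k)\nearrow F(D,X)$ as $k\to\infty$; - (monotonicity) $F(D,U)\le F(D,V)$ whenever $U\subset V$; - (superadditivity) $F(B,U)\ge\sum_{k=1}^M F(B,U_k)$ whenever $U=\bigsqcup_{k=1}^M U_k$ (finite disjoint union of open sets); - ($G$-invariance) $F(gB,gU)=F(B,U)$ for every $g\in G$. If $G$ acts on $X$ properly discontinuously, then \[ \sum_{i\in I}F(E^i,X)\le\liminf_{k}F(E_k,X). \]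
   Context: $(X,d,\mu)$ is a metric measure space with distance $d$ and nonnegative $\sigma$-finite Radon measure $\mu$ with $\mu(X)\neq0$. $G$ is a discrete, countable, topological group acting on $X$ by homeomorphisms preserving the measure $\mu$; the action is properly discontinuous if $\{g\in G: gK\cap K\neq\emptyset\}$ is finite for every compact $K\subset X$. $\mathcal B(X)$ is the Borel $\sigma$-algebra of $X$ and $\mathcal A(X)$ the class of open subsets of $X$. $(X,d)$ has the Heine–Borel property if every closed ball is compact. Convergence of sets $B_k\to B$ in $L^1_{\mathrm{loc}}(\mu)$ means that $\mathbf 1_{B_k}\to\mathbf 1_B$ in $L^1(\mu)$ on every compact subset of $X$. For a sequence $g_k\in G$, $\lim_k g_k=\infty$ means that for every finite $A\subset G$ the set $\{k: g_k\in A\}$ is finite. *)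

theory Defs
  imports "HOL-Analysis.Analysis" "HOL-Algebra.Group_Action"
begin

text \<open>A Radon measure is a Borel measure that is locally finite and inner regular with respect to
  compact sets. In a metric space with compact closed balls every Borel measure that is finite
  on compact sets has both properties.\<close>

definition radon_measure :: "'a::metric_space measure \<Rightarrow> bool" where
  "radon_measure \<mu> \<longleftrightarrow>
     sets \<mu> = sets borel \<and>
     (\<forall>x. \<exists>U. open U \<and> x \<in> U \<and> emeasure \<mu> U < \<infinity>) \<and>
     (\<forall>B\<in>sets borel. emeasure \<mu> B = (SUP K\<in>{K. compact K \<and> K \<subseteq> B}. emeasure \<mu> K))"

definition properly_discontinuous ::
    "('g, 'm) monoid_scheme \<Rightarrow> ('g \<Rightarrow> 'a \<Rightarrow> 'a::topological_space) \<Rightarrow> bool" where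
  "properly_discontinuous G \<phi> \<longleftrightarrow>
     (\<forall>K. compact K \<longrightarrow> finite {g \<in> carrier G. \<phi> g ` K \<inter> K \<noteq> {}})"

definition tends_to_infinity_in :: "('g, 'm) monoid_scheme \<Rightarrow> (nat \<Rightarrow> 'g) \<Rightarrow> bool" where
  "tends_to_infinity_in G g \<longleftrightarrow>
     (\<forall>A. A \<subseteq> carrier G \<and> finite A \<longrightarrow> finite {k. g k \<in> A})"

text \<open>The \<open>L\<^sup>1\<close>-distance of the indicators on a compact set \<open>K\<close> is written as a nonnegative
  (extended-valued) integral, so that no junk value arises from non-integrability.\<close>

definition L1loc_converges ::
    "'a::metric_space measure \<Rightarrow> (nat \<Rightarrow> 'a set) \<Rightarrow> 'a set \<Rightarrow> bool" where
  "L1loc_converges \<mu> B B' \<longleftrightarrow>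
     (\<forall>K. compact K \<longrightarrow>
        (\<lambda>k. \<integral>\<^sup>+x\<in>K. ennreal \<bar>indicator (B k) x - indicator B' x\<bar> \<partial>\<mu>) \<longlonglongrightarrow> 0)"

end

theory Submission
  imports Defs
begin

text \<open>
  A relatively compact open set \<open>U\<close> meets \<open>h U\<close> for only finitely many \<open>h\<close>, because the
  action is properly discontinuous. Since \<open>inv (g i' k) \<otimes> g i k\<close> escapes to infinity for
  \<open>i \<noteq> i'\<close>, the translates \<open>g i k U\<close>, with \<open>i\<close> ranging over a finite set \<open>J\<close> of indices, are
  pairwise disjoint once \<open>k\<close> is large (\<open>eventually_disjoint_translates\<close>). So the pieces of
  \<open>E k\<close> that converge to the different limits \<open>E' i\<close> are seen by \<open>F\<close> in separate parts of the
  space: by invariance, superadditivity and monotonicity,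
  \<open>(\<Sum>i\<in>J. F (inv (g i k) (E k)) U) = (\<Sum>i\<in>J. F (E k) (g i k U)) \<le> F (E k) UNIV\<close>.
  Lower semicontinuity and the superadditivity of \<open>liminf\<close>
  (\<open>sum_liminf_le_liminf_sum_ennreal\<close>) give, as \<open>k\<close> tends to infinity,
  \<open>(\<Sum>i\<in>J. F (E' i) U) \<le> liminf (\<lambda>k. F (E k) UNIV)\<close>.

  The right-hand side depends neither on \<open>U\<close> nor on \<open>J\<close>. Exhausting the space by balls, which
  are relatively compact by the Heine--Borel property, replaces \<open>U\<close> by \<open>UNIV\<close>; a sum of
  nonnegative terms is the supremum of its finite partial sums, so \<open>J\<close> may be replaced by \<open>I\<close>.
\<close>

text \<open>Fatou's lemma for the counting measure on a finite set.\<close>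

lemma sum_liminf_le_liminf_sum_ennreal:
  fixes f :: "'i \<Rightarrow> nat \<Rightarrow> ennreal"
  assumes "finite J"
  shows "(\<Sum>i\<in>J. liminf (f i)) \<le> liminf (\<lambda>k. \<Sum>i\<in>J. f i k)"
  using nn_integral_liminf[of "\<lambda>k i. f i k" "count_space J"] assms
  by (simp add: nn_integral_count_space_finite)

lemma homeomorphism_image_borel:
  fixes f f' :: "'a::topological_space \<Rightarrow> 'a"
  assumes "homeomorphism UNIV UNIV f f'" and "B \<in> sets borel"
  shows "f ` B \<in> sets borel"
proof -
  have "f ` B = f' -` B"
  proof (intro equalityI subsetI)
    fix y assume "y \<in> f ` B"
    then show "y \<in> f' -` B"
      using assms(1) by (auto simp: homeomorphism_def)
  next
    fix y assume "y \<in> f' -` B"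
    moreover have "y = f (f' y)"
      using assms(1) by (simp add: homeomorphism_def)
    ultimately show "y \<in> f ` B"
      by blast
  qed
  moreover have "f' \<in> borel_measurable borel"
    using assms(1) by (intro borel_measurable_continuous_onI) (auto simp: homeomorphism_def)
  ultimately show ?thesis
    using assms(2) measurable_sets_borel by simp
qed

text \<open>A common point of \<open>aK\<close> and \<open>bK\<close> yields a common point of \<open>b\<^sup>-\<^sup>1aK\<close> and \<open>K\<close>, and
  only finitely many values of \<open>b\<^sup>-\<^sup>1a\<close> allow this.\<close>

lemma eventually_disjoint_translates:
  fixes \<phi> :: "'g \<Rightarrow> 'a::topological_space \<Rightarrow> 'a" and G (structure)
  assumes act: "group_action G UNIV \<phi>" and pd: "properly_discontinuous G \<phi>"
    and K: "compact K"
    and a: "\<And>k. a k \<in> carrier G" and b: "\<And>k. b k \<in> carrier G"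
    and inf: "tends_to_infinity_in G (\<lambda>k. inv (b k) \<otimes> a k)"
  shows "\<forall>\<^sub>F k in sequentially. \<phi> (a k) ` K \<inter> \<phi> (b k) ` K = {}"
proof -
  interpret group_action G UNIV \<phi> by (fact act)
  interpret group G by (fact group_hom.axioms(1)[OF group_hom])
  let ?A = "{h \<in> carrier G. \<phi> h ` K \<inter> K \<noteq> {}}"
  have meets: "inv (b k) \<otimes> a k \<in> ?A" if "\<phi> (a k) ` K \<inter> \<phi> (b k) ` K \<noteq> {}" for k
  proof -
    from that obtain x y where xy: "x \<in> K" "y \<in> K" "\<phi> (a k) x = \<phi> (b k) y"
      by blast
    have "\<phi> (inv (b k) \<otimes> a k) x = \<phi> (inv (b k)) (\<phi> (b k) y)"
      using composition_rule[of x "inv (b k)" "a k"] a b xy(3) by simp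
    also have "\<dots> = y"
      using composition_rule[of y "inv (b k)" "b k"] fun_cong[OF id_eq_one, of y] b by simp
    finally show ?thesis
      using xy a b by blast
  qed
  have "finite ?A"
    using pd K by (auto simp: properly_discontinuous_def)
  then have "finite {k. inv (b k) \<otimes> a k \<in> ?A}"
    using inf[unfolded tends_to_infinity_in_def, rule_format, of ?A] by simp
  then have "finite {k. \<phi> (a k) ` K \<inter> \<phi> (b k) ` K \<noteq> {}}"
    using meets by (elim finite_subset[rotated]) blast
  then show ?thesis
    by (simp add: cofinite_eq_sequentially[symmetric] eventually_cofinite)
qed

theorem theorem3p1:
  fixes \<mu> :: "'a::metric_space measure"
    and G :: "('g, 'm) monoid_scheme" (structure)
    and \<phi> :: "'g \<Rightarrow> 'a \<Rightarrow> 'a"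
    and E :: "nat \<Rightarrow> 'a set"
    and I :: "'i set"
    and E' :: "'i \<Rightarrow> 'a set"
    and g :: "'i \<Rightarrow> nat \<Rightarrow> 'g"
    and F :: "'a set \<Rightarrow> 'a set \<Rightarrow> ennreal"
  assumes "radon_measure \<mu>" and "sigma_finite_measure \<mu>" and "emeasure \<mu> UNIV \<noteq> 0"
    and "countable (carrier G)"
    and "group_action G UNIV \<phi>"
    and "\<And>h. h \<in> carrier G \<Longrightarrow> homeomorphism UNIV UNIV (\<phi> h) (\<phi> (inv h))"
    and "\<And>h. h \<in> carrier G \<Longrightarrow> distr \<mu> \<mu> (\<phi> h) = \<mu>"
    and heine_borel: "\<And>(x::'a) r. compact (cball x r)"
    and "\<And>k. E k \<in> sets borel"
    and "countable I"
    and "\<And>i. i \<in> I \<Longrightarrow> E' i \<in> sets borel"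
    and "\<And>i k. i \<in> I \<Longrightarrow> g i k \<in> carrier G"
    and "\<And>i i'. i \<in> I \<Longrightarrow> i' \<in> I \<Longrightarrow> i \<noteq> i' \<Longrightarrow>
           tends_to_infinity_in G (\<lambda>k. inv (g i' k) \<otimes> g i k)"
    and "\<And>i. i \<in> I \<Longrightarrow> L1loc_converges \<mu> (\<lambda>k. \<phi> (inv (g i k)) ` E k) (E' i)"
    and semicontinuity:
      "\<And>B B' U. (\<And>k. B k \<in> sets borel) \<Longrightarrow> B' \<in> sets borel \<Longrightarrow> open U \<Longrightarrow>
         L1loc_converges \<mu> B B' \<Longrightarrow> F B' U \<le> liminf (\<lambda>k. F (B k) U)"
    and beppo_levi:
      "\<And>D U. D \<in> sets borel \<Longrightarrow> (\<And>k::nat. open (U k)) \<Longrightarrow> incseq U \<Longrightarrow> (\<Union>k. U k) = UNIV \<Longrightarrow>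
         incseq (\<lambda>k. F D (U k)) \<and> (\<lambda>k. F D (U k)) \<longlonglongrightarrow> F D UNIV"
    and monotonicity:
      "\<And>D U V. D \<in> sets borel \<Longrightarrow> open U \<Longrightarrow> open V \<Longrightarrow> U \<subseteq> V \<Longrightarrow> F D U \<le> F D V"
    and superadditivity:
      "\<And>B (M::nat) U. B \<in> sets borel \<Longrightarrow> (\<And>k. k \<in> {1..M} \<Longrightarrow> open (U k)) \<Longrightarrow>
         disjoint_family_on U {1..M} \<Longrightarrow> F B (\<Union>k\<in>{1..M}. U k) \<ge> (\<Sum>k=1..M. F B (U k))"
    and invariance:
      "\<And>h B U. h \<in> carrier G \<Longrightarrow> B \<in> sets borel \<Longrightarrow> open U \<Longrightarrow>
         F (\<phi> h ` B) (\<phi> h ` U) = F B U"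
    and "properly_discontinuous G \<phi>"
  shows "(\<Sum>\<^sub>\<infinity>i\<in>I. F (E' i) UNIV) \<le> liminf (\<lambda>k. F (E k) UNIV)"
proof -
  interpret group_action G UNIV \<phi> by fact
  interpret group G by (fact group_hom.axioms(1)[OF group_hom])
  note hom = assms(6)
  note E_borel = assms(9)
  note E'_borel = assms(11)
  note g_carrier = assms(12)
  note diverge = assms(13)
  note converge = assms(14)
  let ?L = "liminf (\<lambda>k. F (E k) UNIV)"

  have undo: "\<phi> h ` \<phi> (inv h) ` B = B" if "h \<in> carrier G" for h B
    using hom[OF that] by (auto simp: homeomorphism_def image_image)
  have open_translate: "open (\<phi> h ` U)" if "h \<in> carrier G" "open U" for h U
    using homeomorphism_imp_open_map[OF hom[OF that(1)], of U] that(2) by simp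
  have translate_borel: "\<phi> (inv (g i k)) ` E k \<in> sets borel" if "i \<in> I" for i k
    using homeomorphism_image_borel[OF hom E_borel] g_carrier[OF that] by simp

  \<comment> \<open>Superadditivity is assumed for families indexed by an initial segment \<open>{1..M}\<close>; an
    enumeration of \<open>J\<close> transfers it to subsets of \<open>I\<close>.\<close>
  have superadditive_finite: "(\<Sum>i\<in>J. F B (V i)) \<le> F B (\<Union>i\<in>J. V i)"
    if "finite J" "B \<in> sets borel" "\<And>i. i \<in> J \<Longrightarrow> open (V i)" "disjoint_family_on V J"
    for J :: "'i set" and B V
  proof -
    obtain e where e: "bij_betw e {1..card J} J"
      using ex_bij_betw_nat_finite_1[OF \<open>finite J\<close>] by blast
    have "disjoint_family_on (\<lambda>n. V (e n)) {1..card J}"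
      unfolding disjoint_family_on_def
    proof (intro ballI impI)
      fix m n assume mn: "m \<in> {1..card J}" "n \<in> {1..card J}" "m \<noteq> n"
      then have "e m \<noteq> e n"
        using e by (auto simp: bij_betw_def dest: inj_onD)
      moreover have "e m \<in> J" "e n \<in> J"
        using bij_betwE[OF e] mn by auto
      ultimately show "V (e m) \<inter> V (e n) = {}"
        using that(4) by (auto simp: disjoint_family_on_def)
    qed
    moreover have "open (V (e n))" if "n \<in> {1..card J}" for n
      using bij_betwE[OF e] that by (intro \<open>\<And>i. i \<in> J \<Longrightarrow> open (V i)\<close>) blast
    ultimately have "(\<Sum>n=1..card J. F B (V (e n))) \<le> F B (\<Union>n\<in>{1..card J}. V (e n))"
      using superadditivity[OF that(2), of "card J" "\<lambda>n. V (e n)"] by blast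
    moreover have "(\<Sum>n=1..card J. F B (V (e n))) = (\<Sum>i\<in>J. F B (V i))"
      using sum.reindex_bij_betw[OF e] .
    moreover have "(\<Union>n\<in>{1..card J}. V (e n)) = (\<Union>i\<in>J. V i)"
      using arg_cong[OF bij_betw_imp_surj_on[OF e], of "\<lambda>A. \<Union>i\<in>A. V i"]
      by (simp only: image_image)
    ultimately show ?thesis by simp
  qed

  have local_bound: "(\<Sum>i\<in>J. F (E' i) U) \<le> ?L"
    if J: "finite J" "J \<subseteq> I" and U: "open U" "U \<subseteq> K" "compact K" for J U K
  proof -
    \<comment> \<open>Only finitely many pairs of indices occur, so one threshold for \<open>k\<close> serves them all.\<close>
    have "\<forall>\<^sub>F k in sequentially. \<forall>i\<in>J. \<forall>i'\<in>J. i \<noteq> i' \<longrightarrow>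
        \<phi> (g i k) ` K \<inter> \<phi> (g i' k) ` K = {}"
    proof (intro eventually_ball_finite J ballI)
      fix i i' assume "i \<in> J" "i' \<in> J"
      then show "\<forall>\<^sub>F k in sequentially. i \<noteq> i' \<longrightarrow> \<phi> (g i k) ` K \<inter> \<phi> (g i' k) ` K = {}"
        using J eventually_disjoint_translates[OF assms(5) \<open>properly_discontinuous G \<phi>\<close> \<open>compact K\<close>
            g_carrier g_carrier diverge]
        by (cases "i = i'") auto
    qed
    then have bound: "\<forall>\<^sub>F k in sequentially.
        (\<Sum>i\<in>J. F (\<phi> (inv (g i k)) ` E k) U) \<le> F (E k) UNIV"
    proof eventually_elim
      case (elim k)
      have V: "open (\<phi> (g i k) ` U)" if "i \<in> J" for i
        using open_translate[OF g_carrier U(1)] J that by blast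
      have "F (\<phi> (inv (g i k)) ` E k) U = F (E k) (\<phi> (g i k) ` U)" if "i \<in> J" for i
      proof -
        have "i \<in> I" using J that by blast
        then show ?thesis
          using invariance[OF g_carrier translate_borel U(1), of i i k k] undo[OF g_carrier] by simp
      qed
      then have "(\<Sum>i\<in>J. F (\<phi> (inv (g i k)) ` E k) U) = (\<Sum>i\<in>J. F (E k) (\<phi> (g i k) ` U))"
        by simp
      also have "\<dots> \<le> F (E k) (\<Union>i\<in>J. \<phi> (g i k) ` U)"
        using J(1) E_borel V
      proof (rule superadditive_finite)
        show "disjoint_family_on (\<lambda>i. \<phi> (g i k) ` U) J"
          using elim U(2) unfolding disjoint_family_on_def by blast
      qed
      also have "\<dots> \<le> F (E k) UNIV"
        using V by (intro monotonicity E_borel) auto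
      finally show ?case .
    qed
    have "(\<Sum>i\<in>J. F (E' i) U) \<le> (\<Sum>i\<in>J. liminf (\<lambda>k. F (\<phi> (inv (g i k)) ` E k) U))"
      using J U(1) by (intro sum_mono semicontinuity translate_borel E'_borel converge) auto
    also have "\<dots> \<le> liminf (\<lambda>k. \<Sum>i\<in>J. F (\<phi> (inv (g i k)) ` E k) U)"
      using J(1) by (rule sum_liminf_le_liminf_sum_ennreal)
    also have "\<dots> \<le> ?L"
      using bound by (rule Liminf_mono)
    finally show ?thesis .
  qed

  have finite_bound: "(\<Sum>i\<in>J. F (E' i) UNIV) \<le> ?L" if J: "finite J" "J \<subseteq> I" for J
  proof -
    fix x0 :: 'a
    define U where "U n = ball x0 (real n)" for n :: nat
    have "incseq U"
      by (auto simp: U_def incseq_def)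
    moreover have "(\<Union>n. U n) = UNIV"
      using reals_Archimedean2 by (auto simp: U_def)
    ultimately have "(\<lambda>n. F (E' i) (U n)) \<longlonglongrightarrow> F (E' i) UNIV" if "i \<in> J" for i
      using beppo_levi[OF E'_borel, of i U] J that by (auto simp: U_def)
    then have "(\<lambda>n. \<Sum>i\<in>J. F (E' i) (U n)) \<longlonglongrightarrow> (\<Sum>i\<in>J. F (E' i) UNIV)"
      by (rule tendsto_sum)
    moreover have "(\<Sum>i\<in>J. F (E' i) (U n)) \<le> ?L" for n
      unfolding U_def by (rule local_bound[OF J open_ball ball_subset_cball heine_borel])
    ultimately show ?thesis
      by (intro LIMSEQ_le_const2) auto
  qed

  have "(\<Sum>\<^sub>\<infinity>i\<in>I. F (E' i) UNIV) = (SUP J\<in>{J. finite J \<and> J \<subseteq> I}. \<Sum>i\<in>J. F (E' i) UNIV)"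
    by (rule nonneg_infsum_complete) simp
  also have "\<dots> \<le> ?L"
    using finite_bound by (intro SUP_least) auto
  finally show ?thesis .
qed

end
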